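(* For an elasticity tensor $C^{ijkl}$ in three dimensions, let $M^{ijkl}:=C^{i(jk)l}$ and $N^{ijkl}:=C^{i[jk]l}$. In general the minor symmetries do not hold for $M$ and $N$; that is, there exists an elasticity tensor $C$ for which none of the identities $M^{[ij]kl}=0$, $M^{ij[kl]}=0$, $N^{[ij]kl}=0$, $N^{ij[kl]}=0$ holds (each fails for at least one choice of the indices).
   Context: Indices run over $1,2,3$. An elasticity tensor is a real fourth-rank tensor $C^{ijkl}$ on $\mathbb R^3$ with $C^{ijkl}=C^{jikl}$, $C^{ijkl}=C^{ijlk}$ (minor symmetries) and $C^{ijkl}=C^{klij}$ (major symmetry). Parentheses/brackets around two indices denote symmetrization/antisymmetrization with factor $\frac12$: $C^{i(jk)l}=\frac12(C^{ijkl}+C^{ikjl})$, $C^{i[jk]l}=\frac12(C^{ijkl}-C^{ikjl})$, $M^{[ij]kl}=\frac12(M^{ijkl}-M^{jikl})$, $M^{ij[kl]}=\frac12(M^{ijkl}-M^{ijlk})$, etc. *)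

theory Defs
  imports "HOL-Analysis.Analysis"
begin

(* The component array of a real fourth-rank tensor on R^3 with respect to the standard basis;
   the index type 3 has exactly three elements, with the numeral 3 denoting the same one as 0. *)
type_synonym tensor4 = "3 \<Rightarrow> 3 \<Rightarrow> 3 \<Rightarrow> 3 \<Rightarrow> real"

definition elasticity_tensor :: "tensor4 \<Rightarrow> bool" where
  "elasticity_tensor C \<longleftrightarrow>
     (\<forall>i j k l. C i j k l = C j i k l) \<and>
     (\<forall>i j k l. C i j k l = C i j l k) \<and>
     (\<forall>i j k l. C i j k l = C k l i j)"

(* T^{i(jk)l} *)
definition sym23 :: "tensor4 \<Rightarrow> tensor4" where
  "sym23 T = (\<lambda>i j k l. (T i j k l + T i k j l) / 2)"

(* T^{i[jk]l} *)
definition alt23 :: "tensor4 \<Rightarrow> tensor4" where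
  "alt23 T = (\<lambda>i j k l. (T i j k l - T i k j l) / 2)"

(* T^{[ij]kl} *)
definition alt12 :: "tensor4 \<Rightarrow> tensor4" where
  "alt12 T = (\<lambda>i j k l. (T i j k l - T j i k l) / 2)"

(* T^{ij[kl]} *)
definition alt34 :: "tensor4 \<Rightarrow> tensor4" where
  "alt34 T = (\<lambda>i j k l. (T i j k l - T i j l k) / 2)"

end

theory Submission
  imports Defs
begin

text \<open>The isotropic tensor \<delta>_ij \<delta>_kl is a witness for all four failures.
  Swapping its middle indices gives \<delta>_ik \<delta>_jl, which lacks both minor symmetries,
  while the unswapped part cancels under either antisymmetrization.\<close>

theorem proposition3:
  shows "\<exists>C :: tensor4. elasticity_tensor C \<and>
    (let M = sym23 C; N = alt23 C in
      \<not> (\<forall>i j k l. alt12 M i j k l = 0) \<and>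
      \<not> (\<forall>i j k l. alt34 M i j k l = 0) \<and>
      \<not> (\<forall>i j k l. alt12 N i j k l = 0) \<and>
      \<not> (\<forall>i j k l. alt34 N i j k l = 0))"
proof -
  define C :: tensor4 where "C = (\<lambda>i j k l. of_bool (i = j) * of_bool (k = l))"
  have "elasticity_tensor C"
    by (auto simp: elasticity_tensor_def C_def)
  \<comment> \<open>At these indices only the swapped term \<open>C 1 1 2 2 = 1\<close> survives, so
    both values are 1/4 for \<open>sym23 C\<close> and -1/4 for \<open>alt23 C\<close>.\<close>
  moreover have "alt12 (sym23 C) 1 2 1 2 \<noteq> 0" "alt34 (sym23 C) 1 2 1 2 \<noteq> 0"
    "alt12 (alt23 C) 1 2 1 2 \<noteq> 0" "alt34 (alt23 C) 1 2 1 2 \<noteq> 0"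
    by (simp_all add: alt12_def alt34_def sym23_def alt23_def C_def)
  ultimately show ?thesis
    unfolding Let_def by blast
qed

end
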